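(* Let $s\ge 0$ and $n \geq 2s$ be integers. Then $$T_{n+1}^{(s)}(x)=x^{n/2}F_{n+1}^{(s)}(x^{3/2})+\sum_{i=1}^{n-2}x^{(i-1)/2}\sum_{j=0}^{s-1} \left(T_{n-i-1}^{(j)}(x)-T_{n-i-1}^{(j-1)}(x)\right)F_i^{(s-j-1)}(x^{3/2}).$$
   Context: For integers $m\ge 0$ and $0\le s\le \lfloor m/2\rfloor$, the incomplete tribonacci polynomial is defined by $$T_{m+1}^{(s)}(x)=\sum_{i=0}^{s}\sum_{j=0}^i \binom{i}{j}\binom{m-i-j}{i}x^{2m-3(i+j)}.$$ For integers $m\ge 1$ and $0\le s\le\lfloor (m-1)/2\rfloor$, the incomplete Fibonacci polynomial is defined by $$F_m^{(s)}(x)=\sum_{r=0}^s \binom{m-r-1}{r}x^{m-2r-1}.$$ Conventions: $T_m^{(-1)}(x)=0$ for all $m\ge 1$. For $m\ge 1$ and $s>\lfloor (m-1)/2\rfloor$, one sets $T_m^{(s)}(x)=T_m^{(\lfloor (m-1)/2\rfloor)}(x)$ and $F_m^{(s)}(x)=F_m^{(\lfloor (m-1)/2\rfloor)}(x)$. Empty sums are $0$. Half-integer powers of $x$ are understood formally in an indeterminate $x^{1/2}$ (equivalently, the identity holds for all real $x>0$ with positive square roots). *)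

theory Defs
  imports Complex_Main "HOL-Computational_Algebra.Polynomial"
begin

(* The two families are defined for lower index m >= 1; the value at m = 0 carries no meaning.
   Replacing s by min s ((m - 1) div 2) encodes the convention that an upper index beyond
   (m - 1) div 2 is read as (m - 1) div 2. *)

(* With k = m - 1 this is the double sum for T_{k+1}^(s).  Since i <= k div 2 and j <= i,
   the subtraction k - i - j never truncates; 2 * k - 3 * (i + j) truncates only when
   (k - i - j) choose i = 0, that is, only in summands that vanish.
   The upper index is an integer so that T_m^(-1) = 0 can be expressed. *)
definition inc_tribonacci :: "nat \<Rightarrow> int \<Rightarrow> real poly" where
  "inc_tribonacci m s =
     (if s < 0 then 0
      else let k = m - 1 in
        \<Sum>i = 0..min (nat s) (k div 2). \<Sum>j = 0..i.
          monom (real ((i choose j) * ((k - i - j) choose i))) (2 * k - 3 * (i + j)))"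

definition inc_fibonacci :: "nat \<Rightarrow> nat \<Rightarrow> real poly" where
  "inc_fibonacci m s =
     (\<Sum>r = 0..min s ((m - 1) div 2).
        monom (real ((m - r - 1) choose r)) (m - 2 * r - 1))"

end

theory Submission
  imports Defs "HOL-Computational_Algebra.Formal_Power_Series"
begin

text \<open>
  Work with power series in an auxiliary variable \<open>y\<close> that marks the lower index, and let
  \<open>q = 1 / (1 - x\<^sup>2 y)\<close>. Fixing the outer summation index \<open>j\<close> and summing over
  the lower index turns the \<open>j\<close>-th summand of the tribonacci polynomials into
  \<open>w ^ j * q ^ (j + 1)\<close> with \<open>w = x y\<^sup>2 + y\<^sup>3\<close>. The Fibonacci polynomials, taken at
  \<open>x powr (3 / 2)\<close> and scaled by a power of \<open>x powr (1 / 2)\<close> that clears all fractional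
  exponents, give in the same way \<open>v ^ j * q ^ (j + 1)\<close> with \<open>v = x y\<^sup>2\<close>
  (\<open>trib_row_nth\<close>, \<open>fib_row_nth\<close>).

  Since \<open>w - v = y\<^sup>3\<close>, the factorisation of \<open>w ^ m - v ^ m\<close> by \<open>w - v\<close> writes
  the \<open>m\<close>-th tribonacci series as the \<open>m\<close>-th Fibonacci series plus \<open>y\<^sup>3\<close> times a sum of
  products of a tribonacci and a Fibonacci series whose indices add up to \<open>m - 1\<close>
  (\<open>trib_row_decomp\<close>). Summing over \<open>m \<le> s\<close> collects the Fibonacci factors into
  incomplete sums (\<open>trib_rows_sum\<close>), while the tribonacci factors stay single rows, that is,
  differences of consecutive incomplete tribonacci polynomials. The coefficient of
  \<open>y ^ n\<close> is the claim; the factor \<open>y\<^sup>3\<close> is what makes the convolution run over lower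
  indices \<open>i\<close> and \<open>n - i - 1\<close> with \<open>1 \<le> i \<le> n - 2\<close>.
\<close>

unbundle fps_syntax

definition geo_power :: "real \<Rightarrow> nat \<Rightarrow> real fps" where
  "geo_power x j = inverse (1 - fps_const (x ^ 2) * fps_X) ^ Suc j"

definition fib_row :: "real \<Rightarrow> nat \<Rightarrow> real fps" where
  "fib_row x j = (fps_const x * fps_X ^ 2) ^ j * geo_power x j"

definition trib_row :: "real \<Rightarrow> nat \<Rightarrow> real fps" where
  "trib_row x j = (fps_const x * fps_X ^ 2 + fps_X ^ 3) ^ j * geo_power x j"

lemma geo_power_nth: "geo_power x j $ p = real ((j + p) choose p) * x ^ (2 * p)"
  unfolding geo_power_def
  by (simp only: fps_inverse_power[symmetric] one_minus_const_fps_X_neg_power'[OF zero_less_Suc])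
     (simp add: power_mult)

text \<open>
  The coefficient vanishes for \<open>k < 2 * j\<close> because \<open>v ^ j\<close> has order \<open>2 * j\<close> in \<open>y\<close>.
  This is exactly the cut-off of the upper index at half the degree, so that in terms of rows
  the convention for large upper indices holds automatically.
\<close>
lemma fib_row_nth:
  "fib_row x j $ k = (if k < 2 * j then 0 else real ((k - j) choose j) * x ^ (2 * k - 3 * j))"
proof -
  have "fib_row x j = fps_const (x ^ j) * (fps_X ^ (2 * j) * geo_power x j)"
    by (simp add: fib_row_def power_mult_distrib power_mult mult.assoc fps_const_power)
  hence "fib_row x j $ k = x ^ j * (if k < 2 * j then 0 else geo_power x j $ (k - 2 * j))"
    by (simp add: fps_X_power_mult_nth)
  moreover have "x ^ j * geo_power x j $ (k - 2 * j) = real ((k - j) choose j) * x ^ (2 * k - 3 * j)"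
    if "2 * j \<le> k"
  proof -
    have "(k - j) choose (k - 2 * j) = (k - j) choose j"
      using that binomial_symmetric[of j "k - j"] by (simp add: mult_2)
    moreover have "j + (k - 2 * j) = k - j" "2 * k - 3 * j = j + 2 * (k - 2 * j)"
      using that by simp_all
    ultimately show ?thesis by (simp add: geo_power_nth power_add)
  qed
  ultimately show ?thesis by simp
qed

text \<open>
  Factoring \<open>w = y\<^sup>2 * (y + x)\<close>, the binomial theorem produces the inner sum: the index
  \<open>l\<close> counts how often \<open>y\<close> is chosen from the \<open>j\<close> factors \<open>y + x\<close>.
\<close>
lemma trib_row_nth:
  "trib_row x j $ k = (if k < 2 * j then 0 else
     (\<Sum>l = 0..j. real ((j choose l) * ((k - j - l) choose j)) * x ^ (2 * k - 3 * (j + l))))"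
proof -
  have "fps_const x * fps_X ^ 2 + fps_X ^ 3 = fps_X ^ 2 * (fps_X + fps_const x)"
    by (simp add: algebra_simps power2_eq_square power3_eq_cube)
  hence "trib_row x j = fps_X ^ (2 * j) * (fps_X + fps_const x) ^ j * geo_power x j"
    by (simp add: trib_row_def power_mult_distrib power_mult)
  also have "\<dots> = (\<Sum>l\<le>j. fps_const (real (j choose l) * x ^ (j - l)) *
      (fps_X ^ (2 * j + l) * geo_power x j))"
    unfolding binomial_ring sum_distrib_left sum_distrib_right
  proof (rule sum.cong)
    fix l assume "l \<in> {..j}"
    have coeff: "of_nat (j choose l) * fps_const x ^ (j - l) = fps_const (real (j choose l) * x ^ (j - l))"
      by (simp add: fps_of_nat[symmetric] fps_const_power)
    thus "fps_X ^ (2 * j) * (of_nat (j choose l) * fps_X ^ l * fps_const x ^ (j - l)) * geo_power x j =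
        fps_const (real (j choose l) * x ^ (j - l)) * (fps_X ^ (2 * j + l) * geo_power x j)"
      unfolding coeff[symmetric] power_add by (simp only: mult_ac)
  qed simp
  finally have "trib_row x j $ k = (\<Sum>l\<le>j. real (j choose l) * x ^ (j - l) *
      (if k < 2 * j + l then 0 else geo_power x j $ (k - (2 * j + l))))"
    by (simp add: fps_sum_nth fps_X_power_mult_nth)
  also have "\<dots> = (if k < 2 * j then 0 else
     (\<Sum>l\<le>j. real ((j choose l) * ((k - j - l) choose j)) * x ^ (2 * k - 3 * (j + l))))"
  proof (cases "k < 2 * j")
    case False
    have "real (j choose l) * x ^ (j - l) *
        (if k < 2 * j + l then 0 else geo_power x j $ (k - (2 * j + l))) =
        real ((j choose l) * ((k - j - l) choose j)) * x ^ (2 * k - 3 * (j + l))"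
      if "l \<le> j" for l
    proof (cases "k < 2 * j + l")
      case True
      \<comment> \<open>The exponent on the right may be truncated here, but its coefficient is zero.\<close>
      hence "(k - j - l) choose j = 0" using False that by (intro binomial_eq_0) auto
      thus ?thesis using True by simp
    next
      case le: False
      have "(k - j - l) choose (k - (2 * j + l)) = (k - j - l) choose j"
        using le binomial_symmetric[of j "k - j - l"] by (simp add: mult_2 diff_diff_left add_ac)
      moreover have "j + (k - (2 * j + l)) = k - j - l"
        "2 * k - 3 * (j + l) = (j - l) + 2 * (k - (2 * j + l))"
        using le that by simp_all
      ultimately show ?thesis using le by (simp add: geo_power_nth power_add)
    qed
    hence "(\<Sum>l\<le>j. real (j choose l) * x ^ (j - l) *
        (if k < 2 * j + l then 0 else geo_power x j $ (k - (2 * j + l)))) =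
        (\<Sum>l\<le>j. real ((j choose l) * ((k - j - l) choose j)) * x ^ (2 * k - 3 * (j + l)))"
      by (intro sum.cong) (simp_all only: atMost_iff)
    thus ?thesis using False by (simp only: if_False)
  qed simp
  finally show ?thesis by (simp add: atMost_atLeast0)
qed

text \<open>
  This is \<open>w ^ m - v ^ m = (w - v) * (\<Sum>j<m. v ^ (m - Suc j) * w ^ j)\<close> multiplied by
  \<open>q ^ Suc m\<close>, whose \<open>m + 1\<close> factors suffice to give \<open>w ^ j\<close> the \<open>j + 1\<close> and
  \<open>v ^ (m - Suc j)\<close> the \<open>m - j\<close> factors they need to become rows.
\<close>
lemma trib_row_decomp:
  "trib_row x m = fib_row x m + fps_X ^ 3 * (\<Sum>j<m. trib_row x j * fib_row x (m - Suc j))"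
proof -
  define q where "q = inverse (1 - fps_const (x ^ 2) * fps_X)"
  define v where "v = fps_const x * fps_X ^ 2"
  define w where "w = v + fps_X ^ 3"
  have "w ^ m - v ^ m = fps_X ^ 3 * (\<Sum>j<m. v ^ (m - Suc j) * w ^ j)"
    using power_diff_sumr2[of w m v] by (simp add: w_def)
  hence pow: "w ^ m = v ^ m + fps_X ^ 3 * (\<Sum>j<m. v ^ (m - Suc j) * w ^ j)"
    by (simp only: diff_eq_eq add.commute)
  have "w ^ m * q ^ Suc m =
      v ^ m * q ^ Suc m + fps_X ^ 3 * ((\<Sum>j<m. v ^ (m - Suc j) * w ^ j) * q ^ Suc m)"
    by (subst pow) (simp only: distrib_right mult.assoc)
  also have "(\<Sum>j<m. v ^ (m - Suc j) * w ^ j) * q ^ Suc m =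
      (\<Sum>j<m. (w ^ j * q ^ Suc j) * (v ^ (m - Suc j) * q ^ Suc (m - Suc j)))"
    unfolding sum_distrib_right
  proof (rule sum.cong)
    fix j assume "j \<in> {..<m}"
    hence "Suc m = Suc j + Suc (m - Suc j)" by simp
    hence "q ^ Suc m = q ^ Suc j * q ^ Suc (m - Suc j)" by (simp only: power_add)
    thus "v ^ (m - Suc j) * w ^ j * q ^ Suc m =
        (w ^ j * q ^ Suc j) * (v ^ (m - Suc j) * q ^ Suc (m - Suc j))"
      by (simp only: mult_ac)
  qed simp
  finally show ?thesis
    by (simp only: trib_row_def fib_row_def geo_power_def q_def v_def w_def mult.assoc)
qed

lemma trib_rows_sum:
  "(\<Sum>m\<le>s. trib_row x m) = (\<Sum>m\<le>s. fib_row x m) +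
     fps_X ^ 3 * (\<Sum>j<s. trib_row x j * (\<Sum>r\<le>s - j - 1. fib_row x r))"
proof (induction s)
  case 0
  show ?case using trib_row_decomp[of x 0] by simp
next
  case (Suc s)
  have "(\<Sum>j<Suc s. trib_row x j * (\<Sum>r\<le>Suc s - j - 1. fib_row x r)) =
      (\<Sum>j<Suc s. trib_row x j * (\<Sum>r<s - j. fib_row x r)) +
      (\<Sum>j<Suc s. trib_row x j * fib_row x (Suc s - Suc j))"
    by (simp only: diff_Suc_1 lessThan_Suc_atMost[symmetric] sum.lessThan_Suc distrib_left
        sum.distrib[symmetric]) (simp add: distrib_left sum.distrib)
  \<comment> \<open>The term \<open>j = s\<close> drops out only for the half-open inner range: truncated subtraction
    would turn the closed range \<open>{..s - j - 1}\<close> into \<open>{..0}\<close> there.\<close>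
  also have "(\<Sum>j<Suc s. trib_row x j * (\<Sum>r<s - j. fib_row x r)) =
      (\<Sum>j<s. trib_row x j * (\<Sum>r\<le>s - j - 1. fib_row x r))"
  proof -
    have "{..s - j - 1} = {..<s - j}" if "j < s" for j
      using that by auto
    thus ?thesis by simp
  qed
  finally show ?case
    using Suc.IH trib_row_decomp[of x "Suc s"] by (simp add: algebra_simps)
qed

lemma poly_inc_tribonacci:
  "poly (inc_tribonacci (Suc k) (int s)) x = (\<Sum>j\<le>s. trib_row x j $ k)"
proof -
  have "poly (inc_tribonacci (Suc k) (int s)) x = (\<Sum>j = 0..min s (k div 2). trib_row x j $ k)"
    by (auto simp: inc_tribonacci_def Let_def poly_sum poly_monom trib_row_nth intro!: sum.cong)
  also have "\<dots> = (\<Sum>j\<le>s. trib_row x j $ k)"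
    by (rule sum.mono_neutral_left) (auto simp: trib_row_nth)
  finally show ?thesis .
qed

lemma poly_inc_tribonacci_diff:
  "poly (inc_tribonacci (Suc k) (int j)) x - poly (inc_tribonacci (Suc k) (int j - 1)) x
     = trib_row x j $ k"
proof (cases j)
  case 0
  have "inc_tribonacci (Suc k) (- 1) = 0" by (simp add: inc_tribonacci_def)
  thus ?thesis using 0 poly_inc_tribonacci[of k 0 x] by simp
next
  case (Suc i)
  hence pred: "int j - 1 = int i" by simp
  show ?thesis unfolding pred poly_inc_tribonacci by (simp add: Suc)
qed

text \<open>
  The half-integer powers combine as
  \<open>k / 2 + 3 / 2 * (k - 2 * r) = 2 * k - 3 * r\<close>, a natural number for
  \<open>2 * r \<le> k\<close>.
\<close>
lemma poly_inc_fibonacci: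
  assumes "x > 0"
  shows "x powr (real k / 2) * poly (inc_fibonacci (Suc k) s) (x powr (3 / 2))
    = (\<Sum>r\<le>s. fib_row x r $ k)"
proof -
  have "x powr (real k / 2) * poly (inc_fibonacci (Suc k) s) (x powr (3 / 2)) =
      (\<Sum>r = 0..min s (k div 2). fib_row x r $ k)"
    unfolding inc_fibonacci_def poly_sum poly_monom sum_distrib_left
  proof (rule sum.cong)
    fix r assume "r \<in> {0..min s (k div 2)}"
    hence r: "2 * r \<le> k" by auto
    have "x powr (real k / 2) * (x powr (3 / 2)) ^ (k - 2 * r) =
        x powr (real k / 2 + 3 / 2 * real (k - 2 * r))"
      using assms by (simp add: powr_power powr_add mult.commute)
    also have "real k / 2 + 3 / 2 * real (k - 2 * r) = real (2 * k - 3 * r)"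
      using r by (simp add: of_nat_diff field_simps)
    also have "x powr \<dots> = x ^ (2 * k - 3 * r)"
      using assms by (rule powr_realpow)
    finally have pow: "x powr (real k / 2) * (x powr (3 / 2)) ^ (k - 2 * r) = x ^ (2 * k - 3 * r)" .
    have idx: "Suc k - r - 1 = k - r" "Suc k - 2 * r - 1 = k - 2 * r"
      by simp_all
    show "x powr (real k / 2) * (real ((Suc k - r - 1) choose r) *
        (x powr (3 / 2)) ^ (Suc k - 2 * r - 1)) = fib_row x r $ k"
      unfolding idx fib_row_nth mult.left_commute[of "x powr (real k / 2)"] pow using r by simp
  qed simp
  also have "\<dots> = (\<Sum>r\<le>s. fib_row x r $ k)"
    by (rule sum.mono_neutral_left) (auto simp: fib_row_nth)
  finally show ?thesis .
qed

theorem mainTheorem6: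
  fixes s n :: nat and x :: real
  assumes "n \<ge> 2 * s" and "x > 0"
  shows "poly (inc_tribonacci (n + 1) (int s)) x =
    x powr (real n / 2) * poly (inc_fibonacci (n + 1) s) (x powr (3 / 2)) +
    (\<Sum>i = 1..n - 2. x powr ((real i - 1) / 2) *
       (\<Sum>j = 0..<s.
          (poly (inc_tribonacci (n - i - 1) (int j)) x
             - poly (inc_tribonacci (n - i - 1) (int j - 1)) x)
          * poly (inc_fibonacci i (s - j - 1)) (x powr (3 / 2))))"
proof -
  define S where "S = (\<Sum>j<s. trib_row x j * (\<Sum>r\<le>s - j - 1. fib_row x r))"
  have term_eq: "x powr ((real i - 1) / 2) *
       (\<Sum>j = 0..<s.
          (poly (inc_tribonacci (n - i - 1) (int j)) x
             - poly (inc_tribonacci (n - i - 1) (int j - 1)) x)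
          * poly (inc_fibonacci i (s - j - 1)) (x powr (3 / 2))) =
      (\<Sum>j<s. trib_row x j $ (n - 2 - i) * (\<Sum>r\<le>s - j - 1. fib_row x r $ (i - 1)))"
    if "i \<in> {1..n - 2}" for i
  proof -
    obtain a where i: "i = Suc a"
      using \<open>i \<in> {1..n - 2}\<close> by (cases i) simp_all
    have idx: "n - i - 1 = Suc (n - 2 - i)"
      using \<open>i \<in> {1..n - 2}\<close> by auto
    have half: "(real (Suc a) - 1) / 2 = real a / 2"
      by simp
    have "x powr ((real i - 1) / 2) * (d * poly (inc_fibonacci i t) (x powr (3 / 2)))
        = d * (\<Sum>r\<le>t. fib_row x r $ (i - 1))" for d t
      unfolding i half mult.left_commute[of _ d]
      by (simp only: poly_inc_fibonacci[OF \<open>x > 0\<close>] diff_Suc_1)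
    thus ?thesis
      unfolding idx poly_inc_tribonacci_diff lessThan_atLeast0
      by (subst sum_distrib_left) (simp only:)
  qed
  have conv: "(fps_X ^ 3 * S) $ n = (\<Sum>i = 1..n - 2. \<Sum>j<s.
      trib_row x j $ (n - 2 - i) * (\<Sum>r\<le>s - j - 1. fib_row x r $ (i - 1)))"
  proof (cases "n < 3")
    case True
    thus ?thesis by (auto simp: fps_X_power_mult_nth)
  next
    case False
    then obtain p where n: "n = p + 3" by (metis add.commute le_Suc_ex not_less)
    have "(fps_X ^ 3 * S) $ n =
        (\<Sum>j<s. \<Sum>i = 0..p. trib_row x j $ (p - i) * (\<Sum>r\<le>s - j - 1. fib_row x r $ i))"
    proof -
      have "(trib_row x j * g) $ p = (\<Sum>i = 0..p. trib_row x j $ (p - i) * g $ i)" for j g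
        by (subst mult.commute) (simp only: fps_mult_nth mult.commute)
      thus ?thesis
        by (simp add: S_def n fps_X_power_mult_nth fps_sum_nth)
    qed
    also have "\<dots> = (\<Sum>i = 0..p. \<Sum>j<s.
        trib_row x j $ (p - i) * (\<Sum>r\<le>s - j - 1. fib_row x r $ i))"
      by (rule sum.swap)
    also have "\<dots> = (\<Sum>i = Suc 0..Suc p. \<Sum>j<s.
        trib_row x j $ (p - (i - 1)) * (\<Sum>r\<le>s - j - 1. fib_row x r $ (i - 1)))"
      by (subst sum.shift_bounds_cl_Suc_ivl) simp
    finally show ?thesis by (auto simp: n intro!: sum.cong)
  qed
  have "(\<Sum>m\<le>s. trib_row x m $ n) = (\<Sum>m\<le>s. fib_row x m $ n) + (fps_X ^ 3 * S) $ n"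
    using arg_cong[OF trib_rows_sum[of x s], of "\<lambda>f. f $ n"] by (simp add: fps_sum_nth S_def)
  also have "(fps_X ^ 3 * S) $ n = (\<Sum>i = 1..n - 2. x powr ((real i - 1) / 2) *
       (\<Sum>j = 0..<s.
          (poly (inc_tribonacci (n - i - 1) (int j)) x
             - poly (inc_tribonacci (n - i - 1) (int j - 1)) x)
          * poly (inc_fibonacci i (s - j - 1)) (x powr (3 / 2))))"
    unfolding conv by (rule sum.cong[OF refl term_eq[symmetric]])
  finally show ?thesis
    unfolding Suc_eq_plus1[symmetric] poly_inc_tribonacci poly_inc_fibonacci[OF \<open>x > 0\<close>] .
qed

end
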